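(* Let $(S_n)_{n\ge0}$ be a Branch sequence with parameters $(p,q,\xi)$ and perturbation sequence $(r_n)_{n\ge0}$. For all $n\ge0$ and $k\ge2$, $$\left\lfloor\frac{p(S_n+r_n)}{q^{1+k}}\right\rfloor=\left\lfloor\frac{pS_n}{q^{1+k}}\right\rfloor=\frac pq\left\lfloor\frac{S_n}{q^k}\right\rfloor+\delta_n^k-\frac{\beta s_n^k}{q}.$$ In other words, for all $j\ge k$, $t_n'^{\,j}=s_n'^{\,j}$ and $\sigma_n^j=\delta_n^j$ are independent of the choice of $r_n\in[-\{S_n\},1-\{S_n\})$.
   Context: Notation: $\lfloor\cdot\rfloor$ and $\{\cdot\}$ are the integer part and the fractional part. Parameters: $p>q>1$ are coprime integers, with Euclidean division $p=\alpha q+\beta$, $\alpha\ge 1$, $1\le\beta\le q-1$, and $\alpha+\beta\le q$; $\xi>1$ is a real number that is not a power of $q$. Branch sequence: a real sequence $(S_n)_{n\ge0}$ with $S_0=\xi/q^{g_0}$, normalized by $g_0=0$ (so $S_0=\xi>1$), such that $\lfloor S_0/q\rfloor\equiv 0$ or $q^2-1 \pmod{q^2}$, and for all $n\ge 0$ $$S_{n+1}=\frac{p(S_n+r_n)}{q^{1+g_{n+1}}},$$ where $(r_n)_{n\ge 0}$ (the perturbation sequence) is a real sequence such that $\lfloor S_n+r_n\rfloor=\lfloor S_n\rfloor$ for every $n$ (equivalently $-\{S_n\}\le r_n<1-\{S_n\}$), and, with $S_n'=\frac{p(S_n+r_n)}{q}$, $g_{n+1}$ is the smallest integer $k\ge0$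 such that $\lfloor S_n'/q^{k+1}\rfloor\equiv 0$ or $q^2-1\pmod{q^2}$. Digits (base-$q$ expansions with digits in $\{0,\dots,q-1\}$, indexed by $j\in\mathbb Z$): $S_n=\sum_j s_n^j q^j$, $\frac{pS_n}{q}=\sum_j s_n'^{\,j}q^j$, $S_n+r_n=\sum_j t_n^jq^j$, $\frac{p(S_n+r_n)}{q}=\sum_j t_n'^{\,j}q^j$. Carries: $(\delta_n^j)_{j\in\mathbb Z}$ is the carry sequence of the addition $\alpha S_n+\beta\frac{S_n}{q}=\frac{pS_n}{q}$, i.e. $\beta s_n^{j+1}+\alpha s_n^j+\delta_n^j=s_n'^{\,j}+q\,\delta_n^{j+1}$; equivalently $\delta_n^j=\left\lfloor\frac{\beta s_n^j+p\{S_n/q^j\}}{q}\right\rfloor$. Similarly $(\sigma_n^j)_{j\in\mathbb Z}$ is the carry sequence of $\alpha(S_n+r_n)+\beta\frac{S_n+r_n}{q}=\frac{p(S_n+r_n)}{q}$, i.e. $\beta t_n^{j+1}+\alpha t_n^j+\sigma_n^j=t_n'^{\,j}+q\,\sigma_n^{j+1}$. *)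

theory Defs
  imports "HOL-Analysis.Infinite_Sum" "HOL-Number_Theory.Cong"
begin

text \<open>The digit of weight \<open>q\<^sup>j\<close>, for \<open>j\<close> any integer, in the base-\<open>q\<close> expansion of \<open>x \<ge> 0\<close>. When
  \<open>x\<close> has two expansions, this picks the one that does not end in an infinite string of
  digits \<open>q - 1\<close>.\<close>

definition digit :: "nat \<Rightarrow> real \<Rightarrow> int \<Rightarrow> int" where
  "digit q x j = \<lfloor>x / real q powi j\<rfloor> mod int q"

lemma digit_nonneg: "q > 1 \<Longrightarrow> 0 \<le> digit q x j"
  and digit_less: "q > 1 \<Longrightarrow> digit q x j < int q"
  by (simp_all add: digit_def)

lemma floor_eq_digit:
  assumes "q > 1"
  shows "\<lfloor>x / real q powi j\<rfloor> = digit q x j + int q * \<lfloor>x / real q powi (j + 1)\<rfloor>"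
proof -
  have "\<lfloor>x / real q powi (j + 1)\<rfloor> = \<lfloor>(x / real q powi j) / real_of_int (int q)\<rfloor>"
    using assms by (simp add: power_int_add)
  also have "\<dots> = \<lfloor>x / real q powi j\<rfloor> div int q"
    by (rule floor_divide_real_eq_div) simp
  finally show ?thesis
    by (simp add: digit_def)
qed

lemma sum_digits:
  assumes "q > 1"
  shows "(\<Sum>j\<in>{- int m..<int m}. of_int (digit q x j) * real q powi j) =
    of_int \<lfloor>x / real q powi (- int m)\<rfloor> * real q powi (- int m) -
    of_int \<lfloor>x / real q powi (int m)\<rfloor> * real q powi (int m)"
proof (induction m)
  case 0
  show ?case by simp
next
  case (Suc m)
  let ?d = "\<lambda>j. of_int (digit q x j) * real q powi j"
  let ?F = "\<lambda>j. of_int \<lfloor>x / real q powi j\<rfloor> * real q powi j"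
  have step: "?d j = ?F j - ?F (j + 1)" for j
    using assms by (subst floor_eq_digit[OF assms]) (simp add: power_int_add algebra_simps)
  have "{- int (Suc m)..<int (Suc m)} =
      insert (- int m - 1) (insert (int m) {- int m..<int m})"
    by auto
  then have "sum ?d {- int (Suc m)..<int (Suc m)} =
      ?d (- int m - 1) + ?d (int m) + sum ?d {- int m..<int m}"
    by simp
  also have "\<dots> = ?F (- int m - 1) - ?F (int m + 1)"
    unfolding Suc.IH step[of "- int m - 1"] step[of "int m"] by simp
  finally have "sum ?d {- int (Suc m)..<int (Suc m)} = ?F (- int m - 1) - ?F (int m + 1)" .
  moreover have "- int m - 1 = - int (Suc m)" "int m + 1 = int (Suc m)"
    by simp_all
  ultimately show ?case
    by (simp only:)
qed

lemma digit_expansion: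
  assumes q: "q > 1" and x: "x \<ge> 0"
  shows "((\<lambda>j. of_int (digit q x j) * real q powi j) has_sum x) UNIV"
proof -
  let ?d = "\<lambda>j. of_int (digit q x j) * real q powi j"
  have nn: "?d j \<ge> 0" for j
    using digit_nonneg[OF q, of x j] by simp
  have le: "sum ?d {- int m..<int m} \<le> x" for m
  proof -
    have "of_int \<lfloor>x / real q powi (- int m)\<rfloor> * real q powi (- int m)
        \<le> x / real q powi (- int m) * real q powi (- int m)"
      by (rule mult_right_mono) auto
    moreover have "x / real q powi (- int m) * real q powi (- int m) = x"
      using q by simp
    moreover have "of_int \<lfloor>x / real q powi (int m)\<rfloor> * real q powi (int m) \<ge> 0"
      using x by simp
    ultimately show ?thesis
      unfolding sum_digits[OF q] by linarith
  qed
  have bound: "sum ?d F \<le> x" if "finite F" for F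
  proof -
    define b where "b = Max (abs ` F)"
    have b: "\<bar>j\<bar> \<le> b" if "j \<in> F" for j
      unfolding b_def using \<open>finite F\<close> that by simp
    have "F \<subseteq> {- int (nat (b + 1))..<int (nat (b + 1))}"
      using b by (auto simp: abs_le_iff) (smt (verit) b)+
    then have "sum ?d F \<le> sum ?d {- int (nat (b + 1))..<int (nat (b + 1))}"
      by (intro sum_mono2) (auto simp: nn)
    with le show ?thesis
      by (rule order_trans[rotated])
  qed
  have big: "\<exists>m. a < sum ?d {- int m..<int m}" if "a < x" for a
  proof -
    obtain m1 where m1: "x < real q ^ m1"
      using real_arch_pow[of "real q" x] q by auto
    obtain m2 where m2: "1 / (x - a) < real q ^ m2"
      using real_arch_pow[of "real q" "1 / (x - a)"] q by auto
    define m where "m = max m1 m2"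
    have "real q ^ m1 \<le> real q ^ m" "real q ^ m2 \<le> real q ^ m"
      using q by (auto simp: m_def intro!: power_increasing)
    with m1 m2 have m: "x < real q ^ m" "1 / (x - a) < real q ^ m"
      by linarith+
    have pos: "real q ^ m > 0"
      using q by simp
    have "\<lfloor>x / real q powi (int m)\<rfloor> = 0"
      using m(1) pos x by (simp add: floor_eq_iff)
    moreover have "a * real q ^ m < of_int \<lfloor>x * real q ^ m\<rfloor>"
    proof -
      have "1 < (x - a) * real q ^ m"
        using m(2) that by (simp add: field_simps)
      then have "a * real q ^ m < x * real q ^ m - 1"
        by (simp add: algebra_simps)
      then show ?thesis by linarith
    qed
    then have "a < of_int \<lfloor>x / real q powi (- int m)\<rfloor> * real q powi (- int m)"
      using pos by (simp add: power_int_minus field_simps)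
    ultimately have "a < sum ?d {- int m..<int m}"
      unfolding sum_digits[OF q] by simp
    then show ?thesis ..
  qed
  show ?thesis
    unfolding has_sum_def
  proof (rule order_tendstoI)
    fix a assume "a < x"
    then obtain m where m: "a < sum ?d {- int m..<int m}"
      using big by blast
    have "a < sum ?d F" if "finite F" "{- int m..<int m} \<subseteq> F" for F
      using m sum_mono2[OF that, of ?d] nn by (meson less_le_trans)
    then show "eventually (\<lambda>F. a < sum ?d F) (finite_subsets_at_top UNIV)"
      unfolding eventually_finite_subsets_at_top
      by (intro exI[of _ "{- int m..<int m}"]) auto
  next
    fix a assume "x < a"
    then show "eventually (\<lambda>F. sum ?d F < a) (finite_subsets_at_top UNIV)"
      unfolding eventually_finite_subsets_at_top
      using bound by (intro exI[of _ "{}"]) (auto intro: le_less_trans)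
  qed
qed

text \<open>The carries of the base-\<open>q\<close> addition \<open>\<alpha> x + \<beta> (x / q)\<close>. The recurrence has no initial
  condition, but requiring integer values at all \<open>j\<close> leaves exactly one solution, see
  \<open>carry_seq_ex1\<close>.\<close>

definition is_carry_seq :: "nat \<Rightarrow> nat \<Rightarrow> nat \<Rightarrow> real \<Rightarrow> (int \<Rightarrow> int) \<Rightarrow> bool" where
  "is_carry_seq q \<alpha> \<beta> x c \<longleftrightarrow>
    (\<forall>j. int \<beta> * digit q x (j + 1) + int \<alpha> * digit q x j + c j =
         digit q (real \<alpha> * x + real \<beta> * (x / real q)) j + int q * c (j + 1))"

definition carry :: "nat \<Rightarrow> nat \<Rightarrow> nat \<Rightarrow> real \<Rightarrow> int \<Rightarrow> int" where
  "carry q \<alpha> \<beta> x = (THE c. is_carry_seq q \<alpha> \<beta> x c)"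

lemma is_carry_seq_unique:
  assumes q: "q > 1" and c: "is_carry_seq q \<alpha> \<beta> x c" and d: "is_carry_seq q \<alpha> \<beta> x d"
  shows "c = d"
proof
  fix j
  have step: "c i - d i = int q * (c (i + 1) - d (i + 1))" for i
    using c[unfolded is_carry_seq_def, rule_format, of i]
      d[unfolded is_carry_seq_def, rule_format, of i]
    by (simp add: algebra_simps)
  have pow: "c j - d j = int q ^ m * (c (j + int m) - d (j + int m))" for m
  proof (induction m)
    case (Suc m)
    then show ?case
      using step[of "j + int m"] by (simp add: algebra_simps)
  qed simp
  show "c j = d j"
  proof (rule ccontr)
    assume ne: "c j \<noteq> d j"
    obtain m where m: "\<bar>real_of_int (c j - d j)\<bar> < real q ^ m"
      using real_arch_pow[of "real q"] q by auto
    then have "real_of_int \<bar>c j - d j\<bar> < real_of_int (int q ^ m)"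
      by simp
    then have "\<bar>c j - d j\<bar> < int q ^ m"
      by (simp only: of_int_less_iff)
    moreover have "int q ^ m dvd c j - d j"
      using pow[of m] by (metis dvd_triv_left)
    ultimately show False
      using ne by (metis abs_of_nonneg dvd_imp_le_int eq_iff_diff_eq_0 linorder_not_less
          of_nat_0_le_iff zero_le_power)
  qed
qed

lemma is_carry_seq_floor_diff:
  assumes q: "q > 1"
  shows "is_carry_seq q \<alpha> \<beta> x
    (\<lambda>j. \<lfloor>(real \<alpha> * x + real \<beta> * (x / real q)) / real q powi j\<rfloor>
       - int \<alpha> * \<lfloor>x / real q powi j\<rfloor> - int \<beta> * \<lfloor>x / real q powi (j + 1)\<rfloor>)"
  unfolding is_carry_seq_def
proof
  fix j
  let ?y = "real \<alpha> * x + real \<beta> * (x / real q)"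
  show "int \<beta> * digit q x (j + 1) + int \<alpha> * digit q x j +
      (\<lfloor>?y / real q powi j\<rfloor> - int \<alpha> * \<lfloor>x / real q powi j\<rfloor> - int \<beta> * \<lfloor>x / real q powi (j + 1)\<rfloor>) =
      digit q ?y j + int q * (\<lfloor>?y / real q powi (j + 1)\<rfloor>
        - int \<alpha> * \<lfloor>x / real q powi (j + 1)\<rfloor> - int \<beta> * \<lfloor>x / real q powi (j + 1 + 1)\<rfloor>)"
    using floor_eq_digit[OF q, of x j] floor_eq_digit[OF q, of x "j + 1"]
      floor_eq_digit[OF q, of ?y j]
    by (simp add: algebra_simps)
qed

lemma carry_seq_ex1: "q > 1 \<Longrightarrow> \<exists>!c. is_carry_seq q \<alpha> \<beta> x c"
  using is_carry_seq_floor_diff is_carry_seq_unique by blast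

lemma carry_eqI: "q > 1 \<Longrightarrow> is_carry_seq q \<alpha> \<beta> x c \<Longrightarrow> carry q \<alpha> \<beta> x = c"
  unfolding carry_def using is_carry_seq_unique by blast

lemma carry_eq_floor:
  assumes q: "q > 1" and p: "p = \<alpha> * q + \<beta>"
  shows "carry q \<alpha> \<beta> x j =
    \<lfloor>(real \<beta> * of_int (digit q x j) + real p * frac (x / real q powi j)) / real q\<rfloor>"
proof -
  let ?y = "real \<alpha> * x + real \<beta> * (x / real q)"
  define u where "u = x / real q powi j"
  define N M where "N = \<lfloor>u\<rfloor>" and "M = \<lfloor>x / real q powi (j + 1)\<rfloor>"
  have N: "N = digit q x j + int q * M"
    unfolding N_def M_def u_def by (rule floor_eq_digit[OF q])
  have "?y / real q powi j = real p * u / real q"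
    using q by (simp add: u_def p field_simps)
  also have "\<dots> = (real \<beta> * of_int (digit q x j) + real p * frac u) / real q
      + of_int (int \<alpha> * N + int \<beta> * M)"
  proof -
    have "u = of_int N + frac u"
      by (simp add: N_def frac_def)
    then have "real p * u = real p * of_int N + real p * frac u"
      by (metis distrib_left)
    also have "real p * of_int N = real q * (real \<alpha> * of_int N) + real \<beta> * of_int N"
      by (simp add: p algebra_simps)
    also have "real \<beta> * of_int N
        = real \<beta> * of_int (digit q x j) + real q * (real \<beta> * of_int M)"
      by (subst N) (simp add: algebra_simps)
    finally show ?thesis
      using q by (simp add: field_simps)
  qed
  finally have "\<lfloor>?y / real q powi j\<rfloor> =
      \<lfloor>(real \<beta> * of_int (digit q x j) + real p * frac u) / real q\<rfloor> + (int \<alpha> * N + int \<beta> * M)"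
    by (simp only: floor_add_int)
  then show ?thesis
    unfolding carry_eqI[OF q is_carry_seq_floor_diff[OF q]]
    by (simp add: N_def M_def u_def)
qed

definition branch_cond :: "nat \<Rightarrow> real \<Rightarrow> bool" where
  "branch_cond q y \<longleftrightarrow>
    [\<lfloor>y\<rfloor> = 0] (mod (int q)\<^sup>2) \<or> [\<lfloor>y\<rfloor> = (int q)\<^sup>2 - 1] (mod (int q)\<^sup>2)"

text \<open>The \<open>LEAST\<close> below is always attained, see \<open>branch_cond_ex\<close>.\<close>

definition branch_sequence ::
    "nat \<Rightarrow> nat \<Rightarrow> real \<Rightarrow> (nat \<Rightarrow> nat) \<Rightarrow> (nat \<Rightarrow> real) \<Rightarrow> (nat \<Rightarrow> real) \<Rightarrow> bool" where
  "branch_sequence p q \<xi> g S r \<longleftrightarrow>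
    g 0 = 0 \<and> S 0 = \<xi> / real q ^ g 0 \<and> branch_cond q (S 0 / real q) \<and>
    (\<forall>n. \<lfloor>S n + r n\<rfloor> = \<lfloor>S n\<rfloor> \<and>
         g (Suc n) = (LEAST k. branch_cond q ((real p * (S n + r n) / real q) / real q ^ (k + 1))) \<and>
         S (Suc n) = real p * (S n + r n) / real q ^ (1 + g (Suc n)))"

lemma branch_cond_ex:
  assumes "q > 1"
  shows "\<exists>k. branch_cond q (y / real q ^ (k + 1))"
proof -
  obtain k where "\<bar>y\<bar> < real q ^ k"
    using real_arch_pow[of "real q"] assms by auto
  moreover have "real q ^ k \<le> real q ^ (k + 1)"
    using assms by (intro power_increasing) auto
  ultimately have *: "\<bar>y\<bar> < real q ^ (k + 1)"
    by linarith
  have pos: "real q ^ (k + 1) > 0"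
    using assms by simp
  have "-1 < y / real q ^ (k + 1)" "y / real q ^ (k + 1) < 1"
    using * by (simp_all only: pos_less_divide_eq[OF pos] pos_divide_less_eq[OF pos])
  then have "\<lfloor>y / real q ^ (k + 1)\<rfloor> = 0 \<or> \<lfloor>y / real q ^ (k + 1)\<rfloor> = -1"
    by linarith
  then show ?thesis
    unfolding branch_cond_def by (intro exI[of _ k]) (auto simp: cong_iff_dvd_diff simp del: power_Suc)
qed

end

theory Submission
  imports Defs
begin

text \<open>The hypothesis \<open>\<alpha> + \<beta> \<le> q\<close> gives \<open>p < q\<^sup>2\<close>. By the branch condition all reals with the same
  integer part as \<open>S\<^sub>n\<close> lie within distance \<open>q\<close> of a multiple \<open>q\<^sup>3 A\<close>, on one and the same side
  of it, so that \<open>p\<close> times these reals stay within distance \<open>p q < q\<^sup>3\<close> of \<open>p q\<^sup>3 A\<close>, again on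
  one side: no multiple of \<open>q\<^sup>3\<close>, and a fortiori of \<open>q\<^bsup>j+1\<^esup>\<close> with \<open>j \<ge> 2\<close>, is crossed.\<close>

text \<open>Dividing by \<open>q ^ i\<close> and taking the floor is integer division of
  \<lfloor>x\<rfloor>, so the fractional part of \<open>x\<close> has no influence.\<close>

lemma floor_divide_power_cong:
  fixes x y :: real
  assumes "\<lfloor>x\<rfloor> = \<lfloor>y\<rfloor>"
  shows "\<lfloor>x / real q ^ i\<rfloor> = \<lfloor>y / real q ^ i\<rfloor>"
  using floor_divide_real_eq_div[of "int q ^ i" x] floor_divide_real_eq_div[of "int q ^ i" y] assms
  by simp

text \<open>The residue \<open>q^2 - 1\<close> is read as \<open>-1\<close>: then \<open>y\<close>
  lies in the unit interval just above or just below a multiple of \<open>q^2\<close>.\<close>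

lemma branch_cond_cases:
  assumes "branch_cond q y"
  obtains A where "\<lfloor>y\<rfloor> = (int q)\<^sup>2 * A" | A where "\<lfloor>y\<rfloor> = (int q)\<^sup>2 * A - 1"
proof -
  from assms consider "(int q)\<^sup>2 dvd \<lfloor>y\<rfloor>" | "(int q)\<^sup>2 dvd \<lfloor>y\<rfloor> - ((int q)\<^sup>2 - 1)"
    unfolding branch_cond_def by (auto simp: cong_iff_dvd_diff)
  then show thesis
  proof cases
    case 1
    then show thesis using that(1) by (auto elim: dvdE)
  next
    case 2
    then obtain A where "\<lfloor>y\<rfloor> - ((int q)\<^sup>2 - 1) = (int q)\<^sup>2 * A" by (auto elim: dvdE)
    then have "\<lfloor>y\<rfloor> = (int q)\<^sup>2 * (A + 1) - 1" by (simp add: algebra_simps)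
    then show thesis by (rule that(2))
  qed
qed

text \<open>With \<open>u\<close> the signed offset of \<open>x / q\<close> from
  \<open>q^2 * A\<close>, the quotient \<open>p * x / q^3\<close> is \<open>p * A\<close> plus
  \<open>u\<close> scaled by \<open>p / q^2\<close>. This factor lies in (0,1], so it maps [0,1) and
  [-1,0) into themselves.\<close>

lemma floor_mult_divide_cube:
  fixes x :: real and p q :: nat
  assumes q: "q > 0" and p: "p > 0" "p \<le> q\<^sup>2"
  shows "\<lfloor>x / real q\<rfloor> = (int q)\<^sup>2 * A \<Longrightarrow> \<lfloor>real p * x / real q ^ 3\<rfloor> = int p * A"
    and "\<lfloor>x / real q\<rfloor> = (int q)\<^sup>2 * A - 1 \<Longrightarrow> \<lfloor>real p * x / real q ^ 3\<rfloor> = int p * A - 1"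
proof -
  define u where "u = x / real q - (real q)\<^sup>2 * of_int A"
  have eq: "real p * x / real q ^ 3 = of_int (int p * A) + real p / (real q)\<^sup>2 * u"
    using q by (simp add: u_def field_simps power2_eq_square power3_eq_cube)
  have c: "0 < real p / (real q)\<^sup>2" "real p / (real q)\<^sup>2 \<le> 1"
    using p q by (simp_all add: divide_le_eq flip: of_nat_power)
  show "\<lfloor>real p * x / real q ^ 3\<rfloor> = int p * A" if "\<lfloor>x / real q\<rfloor> = (int q)\<^sup>2 * A"
  proof -
    have "0 \<le> u" "u < 1"
      using that unfolding u_def floor_eq_iff by simp_all
    then have "0 \<le> real p / (real q)\<^sup>2 * u" "real p / (real q)\<^sup>2 * u < 1"
      using c mult_left_le_one_le[of u "real p / (real q)\<^sup>2"] by auto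
    then show ?thesis
      unfolding eq floor_eq_iff by simp
  qed
  show "\<lfloor>real p * x / real q ^ 3\<rfloor> = int p * A - 1" if "\<lfloor>x / real q\<rfloor> = (int q)\<^sup>2 * A - 1"
  proof -
    have u: "- 1 \<le> u" "u < 0"
      using that unfolding u_def floor_eq_iff by simp_all
    then have "real p / (real q)\<^sup>2 * u < 0" "- 1 \<le> real p / (real q)\<^sup>2 * u"
      using c mult_left_le_one_le[of "- u" "real p / (real q)\<^sup>2"] mult_pos_neg[OF c(1) u(2)] by auto
    then show ?thesis
      unfolding eq floor_eq_iff by simp
  qed
qed

text \<open>The case \<open>j = 2\<close> is the cube lemma with the same \<open>A\<close> for
  \<open>x\<close> and \<open>y\<close>. A larger \<open>j\<close> only divides further by
  \<open>q ^ (j - 2)\<close>, which respects equality of floors.\<close>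

lemma branch_floor_mult_cong:
  fixes x y :: real and p q :: nat
  assumes "q > 0" "p > 0" "p \<le> q\<^sup>2" and xy: "\<lfloor>x\<rfloor> = \<lfloor>y\<rfloor>"
    and "branch_cond q (y / real q)" and "j \<ge> 2"
  shows "\<lfloor>real p * x / real q ^ (1 + j)\<rfloor> = \<lfloor>real p * y / real q ^ (1 + j)\<rfloor>"
proof -
  have "\<lfloor>x / real q\<rfloor> = \<lfloor>y / real q\<rfloor>"
    using floor_divide_power_cong[OF xy, of q 1] by simp
  with assms have "\<lfloor>real p * x / real q ^ 3\<rfloor> = \<lfloor>real p * y / real q ^ 3\<rfloor>"
    by (auto elim!: branch_cond_cases simp: floor_mult_divide_cube)
  then have "\<lfloor>real p * x / real q ^ 3 / real q ^ (j - 2)\<rfloor> = \<lfloor>real p * y / real q ^ 3 / real q ^ (j - 2)\<rfloor>"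
    by (rule floor_divide_power_cong)
  moreover have "real q ^ (1 + j) = real q ^ 3 * real q ^ (j - 2)"
    using \<open>j \<ge> 2\<close> by (simp flip: power_add)
  ultimately show ?thesis by simp
qed

lemma branch_sequence_branch_cond:
  assumes "q > 1" "branch_sequence p q \<xi> g S r"
  shows "branch_cond q (S n / real q)"
proof (cases n)
  case 0
  with assms show ?thesis unfolding branch_sequence_def by blast
next
  case (Suc m)
  let ?y = "real p * (S m + r m) / real q"
  have "branch_cond q (?y / real q ^ (g n + 1))"
    using assms LeastI_ex[OF branch_cond_ex[OF assms(1), of ?y]] Suc
    by (simp add: branch_sequence_def)
  \<comment> \<open>\<open>S n\<close> is \<open>?y\<close> divided by \<open>q ^ g n\<close>; the
    extra factor \<open>q\<close> matches the exponent \<open>k + 1\<close> in the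
    \<open>LEAST\<close> that defines \<open>g n\<close>.\<close>
  moreover have "S n / real q = ?y / real q ^ (g n + 1)"
    using assms Suc by (simp add: branch_sequence_def)
  ultimately show ?thesis by simp
qed

text \<open>The carry into a position is the floor of the whole sum there minus the floors of its
  summands, so three floors determine it.\<close>

lemma carry_nat:
  assumes q: "q > 1" and p: "p = \<alpha> * q + \<beta>"
  shows "carry q \<alpha> \<beta> x (int i) = \<lfloor>real p * x / real q ^ (1 + i)\<rfloor>
    - int \<alpha> * \<lfloor>x / real q ^ i\<rfloor> - int \<beta> * \<lfloor>x / real q ^ (1 + i)\<rfloor>"
proof -
  have "(real \<alpha> * x + real \<beta> * (x / real q)) / real q ^ i = real p * x / real q ^ (1 + i)"
    using q by (simp add: p field_simps)
  moreover have "real q powi (int i + 1) = real q ^ (1 + i)"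
    using power_int_of_nat[of "real q" "1 + i"] by (simp add: add.commute)
  ultimately show ?thesis
    unfolding carry_eqI[OF q is_carry_seq_floor_diff[OF q]] by simp
qed

text \<open>\<open>carry_nat\<close> solved for its first floor. As \<open>p / q\<close> is \<alpha>
  + \<beta> / \<open>q\<close>, multiplying \<lfloor>\<open>x / q^k\<close>\<rfloor> by it
  overshoots by \<beta> / \<open>q\<close> times the last digit of that integer, the remainder lost
  in passing to \<open>q^(1+k)\<close>.\<close>

lemma floor_mult_eq_carry:
  assumes q: "q > 1" and p: "p = \<alpha> * q + \<beta>"
  shows "real_of_int \<lfloor>real p * x / real q ^ (1 + k)\<rfloor> =
      real p / real q * real_of_int \<lfloor>x / real q ^ k\<rfloor>
        + real_of_int (carry q \<alpha> \<beta> x (int k))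
        - real \<beta> * real_of_int (digit q x (int k)) / real q"
proof -
  define M where "M = \<lfloor>x / real q ^ (1 + k)\<rfloor>"
  have "real q powi (int k + 1) = real q ^ (1 + k)"
    using power_int_of_nat[of "real q" "1 + k"] by (simp add: add.commute)
  then have N: "\<lfloor>x / real q ^ k\<rfloor> = digit q x (int k) + int q * M"
    using floor_eq_digit[OF q, of x "int k"] by (simp add: M_def)
  have "real p / real q * real_of_int \<lfloor>x / real q ^ k\<rfloor>
      - real \<beta> * real_of_int (digit q x (int k)) / real q
      = real \<alpha> * real_of_int \<lfloor>x / real q ^ k\<rfloor> + real \<beta> * real_of_int M"
    using q by (simp add: N p field_simps)
  then show ?thesis
    unfolding carry_nat[OF assms] M_def by simp
qed

theorem lemma2p1:
  fixes p q \<alpha> \<beta> n k :: nat and \<xi> :: real and g :: "nat \<Rightarrow> nat" and S r :: "nat \<Rightarrow> real"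
  assumes "p > q" and "q > 1" and "coprime p q"
    and "p = \<alpha> * q + \<beta>" and "\<alpha> \<ge> 1" and "1 \<le> \<beta>" and "\<beta> \<le> q - 1" and "\<alpha> + \<beta> \<le> q"
    and "\<xi> > 1" and "\<nexists>m::nat. \<xi> = real q ^ m"
    and "branch_sequence p q \<xi> g S r"
    and "k \<ge> 2"
  shows "\<lfloor>real p * (S n + r n) / real q ^ (1 + k)\<rfloor> = \<lfloor>real p * S n / real q ^ (1 + k)\<rfloor> \<and>
    real_of_int \<lfloor>real p * S n / real q ^ (1 + k)\<rfloor> =
      real p / real q * real_of_int \<lfloor>S n / real q ^ k\<rfloor>
        + real_of_int (carry q \<alpha> \<beta> (S n) (int k))
        - real \<beta> * real_of_int (digit q (S n) (int k)) / real q \<and>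
    (\<forall>j \<ge> int k.
      digit q (real p * (S n + r n) / real q) j = digit q (real p * S n / real q) j \<and>
      carry q \<alpha> \<beta> (S n + r n) j = carry q \<alpha> \<beta> (S n) j) \<and>
    (\<forall>\<rho> \<in> {- frac (S n) ..< 1 - frac (S n)}. \<forall>j \<ge> int k.
      digit q (real p * (S n + \<rho>) / real q) j = digit q (real p * S n / real q) j \<and>
      carry q \<alpha> \<beta> (S n + \<rho>) j = carry q \<alpha> \<beta> (S n) j)"
proof -
  have q: "q > 1" and p: "p = \<alpha> * q + \<beta>" and branch: "branch_sequence p q \<xi> g S r"
    by fact+
  have "\<alpha> * q + \<beta> \<le> \<alpha> * q + \<beta> * q"
    using q by simp
  also have "\<dots> = (\<alpha> + \<beta>) * q"
    by (simp add: distrib_right)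
  also have "\<dots> \<le> q * q"
    using \<open>\<alpha> + \<beta> \<le> q\<close> by (rule mult_le_mono1)
  finally have pq: "p \<le> q\<^sup>2"
    by (simp add: p power2_eq_square)
  \<comment> \<open>Stated for any \<open>x\<close> with the floor of \<open>S n\<close>, to cover
    both the given \<open>r n\<close> and an arbitrary \<rho>.\<close>
  have floor_cong: "\<lfloor>real p * x / real q ^ (1 + i)\<rfloor> = \<lfloor>real p * S n / real q ^ (1 + i)\<rfloor>"
    if "\<lfloor>x\<rfloor> = \<lfloor>S n\<rfloor>" "i \<ge> 2" for x i
    using q \<open>p > q\<close> pq that branch_sequence_branch_cond[OF q branch]
    by (intro branch_floor_mult_cong) auto
  have digit_carry: "digit q (real p * x / real q) j = digit q (real p * S n / real q) j \<and>
      carry q \<alpha> \<beta> x j = carry q \<alpha> \<beta> (S n) j" if x: "\<lfloor>x\<rfloor> = \<lfloor>S n\<rfloor>" and j: "j \<ge> int k" for x j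
  proof -
    obtain i where i: "j = int i" "i \<ge> 2"
      using j \<open>k \<ge> 2\<close> by (cases j) auto
    show ?thesis
      \<comment> \<open>The digit is the first floor modulo \<open>q\<close>; the carry combines all
        three.\<close>
      using floor_cong[OF x i(2)] floor_divide_power_cong[OF x, of q i] floor_divide_power_cong[OF x, of q "1 + i"]
      by (simp add: i(1) digit_def carry_nat[OF q p])
  qed
  have r: "\<lfloor>S n + r n\<rfloor> = \<lfloor>S n\<rfloor>"
    using branch by (simp add: branch_sequence_def)
  have "\<lfloor>S n + \<rho>\<rfloor> = \<lfloor>S n\<rfloor>" if "\<rho> \<in> {- frac (S n) ..< 1 - frac (S n)}" for \<rho>
    using that by (simp add: floor_eq_iff frac_def)
  with r show ?thesis
    using floor_cong[OF r \<open>k \<ge> 2\<close>] floor_mult_eq_carry[OF q p] digit_carry by blast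
qed

end
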